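(* (i) For every $a > 1$ and $b \geq \frac{a}{a-1}$ there is a constant $c$ such that for all sufficiently large $k$, there is an unsatisfiable $k$-CNF formula $F$ with $\mathrm{occ}_F(\bar{x}) \leq c k^2 a^k$ and $\mathrm{occ}_F(x) \leq c k^2 b^k$ for all variables $x$. (ii) Let $1 < a < \sqrt{2}$ and $b = \sqrt{\frac{a^4}{a^2-1}}$. Then every $k$-CNF formula $F$ with $\mathrm{occ}_F(x) \leq \frac{b^k}{8k}$ and $\mathrm{occ}_F(\bar{x}) \leq \frac{a^k}{8k}$ for all variables $x$ is satisfiable.
   Context: A CNF formula is a set of clauses, each a set of literals (no repeated literal, no variable together with its negation); a $k$-CNF formula has all clauses of size exactly $k$. For a literal $u$, $\mathrm{occ}_F(u)$ denotes the number of clauses of $F$ containing $u$. *)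

theory Defs
  imports Complex_Main
begin

datatype 'v literal = Pos 'v | Neg 'v

definition is_clause :: "'v literal set \<Rightarrow> bool" where
  "is_clause C \<longleftrightarrow> finite C \<and> (\<forall>x. \<not> (Pos x \<in> C \<and> Neg x \<in> C))"

text \<open>Formulas are finite, as usual; this also makes the cardinality in \<open>occ\<close> meaningful.\<close>

definition is_cnf :: "'v literal set set \<Rightarrow> bool" where
  "is_cnf F \<longleftrightarrow> finite F \<and> (\<forall>C\<in>F. is_clause C)"

definition is_kcnf :: "nat \<Rightarrow> 'v literal set set \<Rightarrow> bool" where
  "is_kcnf k F \<longleftrightarrow> is_cnf F \<and> (\<forall>C\<in>F. card C = k)"

definition occ :: "'v literal set set \<Rightarrow> 'v literal \<Rightarrow> nat" where
  "occ F u = card {C \<in> F. u \<in> C}"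

fun lit_true :: "('v \<Rightarrow> bool) \<Rightarrow> 'v literal \<Rightarrow> bool" where
  "lit_true \<alpha> (Pos x) \<longleftrightarrow> \<alpha> x"
| "lit_true \<alpha> (Neg x) \<longleftrightarrow> \<not> \<alpha> x"

definition satisfiable :: "'v literal set set \<Rightarrow> bool" where
  "satisfiable F \<longleftrightarrow> (\<exists>\<alpha>. \<forall>C\<in>F. \<exists>u\<in>C. lit_true \<alpha> u)"

end

theory Submission
  imports Defs
begin

text \<open>
  Part (i): on \<open>n = O(k\<^sup>2)\<close> variables every assignment makes a fraction \<open>1/a\<close> of them true or a
  fraction \<open>1/b\<close> of them false. A \<open>k\<close>-subset of the variables lies inside a fixed set of density
  \<open>1/a\<close> with probability at least \<open>a\<^sup>-\<^sup>k/2\<close>, so \<open>O(n a\<^sup>k)\<close> purely negative clauses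
  falsify all assignments of the first kind, and likewise \<open>O(n b\<^sup>k)\<close> purely positive ones all of
  the second kind. Occurrences are bounded by the total number of clauses of each sign.

  Part (ii): set every variable to true with probability \<open>p = 1/a\<^sup>2\<close>, so \<open>p (1 - p) = 1/b\<^sup>2\<close> and
  \<open>p > 1/2\<close>. Delete the positive literals from every clause in which they are the minority. A
  truncated clause is falsified with probability at most \<open>1/a\<^sup>k\<close>, any other one with probability at
  most \<open>1/b\<^sup>k\<close>. A positive literal now occurs only in clauses of the latter kind, so the
  lopsided local lemma, in which only conflicting clauses count as neighbours, applies.
\<close>

section \<open>Part (i): small families of \<open>k\<close>-sets and unsatisfiable formulas\<close>

section \<open>Greedy covering\<close>

text \<open>Averaging: by double counting related pairs, some member of \<open>K\<close> handles at
  least a fraction \<open>p\<close> of the elements of \<open>U\<close> not yet handled. Choosing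
  such a member in each round shrinks the remainder by a factor \<open>1 - p\<close>.\<close>

lemma greedy_cover:
  fixes p :: real
  assumes "finite K" "K \<noteq> {}" "finite U"
    and many: "\<And>S. S \<in> U \<Longrightarrow> p * card K \<le> card {A \<in> K. R A S}"
    and "p \<le> 1"
  shows "\<exists>K'\<subseteq>K. card K' \<le> N \<and> card {S \<in> U. \<forall>A\<in>K'. \<not> R A S} \<le> (1 - p) ^ N * card U"
proof (induction N)
  case 0
  show ?case by (rule exI[of _ "{}"]) simp
next
  case (Suc N)
  then obtain K' where K': "K' \<subseteq> K" "card K' \<le> N"
    and le: "card {S \<in> U. \<forall>A\<in>K'. \<not> R A S} \<le> (1 - p) ^ N * card U" by blast
  define W where "W = {S \<in> U. \<forall>A\<in>K'. \<not> R A S}"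
  have finW: "finite W" using assms(3) unfolding W_def by simp
  have "\<exists>A\<in>K. p * card W \<le> card {S \<in> W. R A S}"
  proof (rule ccontr)
    assume "\<not> ?thesis"
    then have "(\<Sum>A\<in>K. real (card {S \<in> W. R A S})) < (\<Sum>A\<in>K. p * card W)"
      by (intro sum_strict_mono) (use assms in auto)
    also have "\<dots> = (\<Sum>S\<in>W. p * card K)" by simp
    also have "\<dots> \<le> (\<Sum>S\<in>W. real (card {A \<in> K. R A S}))"
      by (intro sum_mono many) (simp add: W_def)
    also have "\<dots> = (\<Sum>A\<in>K. real (card {S \<in> W. R A S}))"
      using sum.swap_restrict[OF finW assms(1), of "\<lambda>_ _. 1::real" "\<lambda>S A. R A S"] by simp
    finally show False by simp
  qed
  then obtain A where A: "A \<in> K" "p * card W \<le> card {S \<in> W. R A S}" by blast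
  have fK': "finite K'" using K' assms(1) finite_subset by blast
  have "{S \<in> U. \<forall>B\<in>insert A K'. \<not> R B S} = W - {S \<in> W. R A S}"
    unfolding W_def by blast
  moreover have "card (W - {S \<in> W. R A S}) = card W - card {S \<in> W. R A S}"
    using finW by (intro card_Diff_subset) auto
  moreover have "card {S \<in> W. R A S} \<le> card W" using finW by (intro card_mono) auto
  ultimately have "real (card {S \<in> U. \<forall>B\<in>insert A K'. \<not> R B S}) = real (card W) - card {S \<in> W. R A S}"
    by (simp add: of_nat_diff)
  also have "\<dots> \<le> (1 - p) * card W" using A by (simp add: algebra_simps)
  also have "\<dots> \<le> (1 - p) * ((1 - p) ^ N * card U)"
    using le \<open>p \<le> 1\<close> unfolding W_def by (intro mult_left_mono) auto
  finally have "card {S \<in> U. \<forall>B\<in>insert A K'. \<not> R B S} \<le> (1 - p) ^ Suc N * card U"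
    by (simp add: mult.assoc)
  moreover have "card (insert A K') \<le> Suc N"
    using K' fK' by (simp add: card_insert_if)
  ultimately show ?case using A K' by (intro exI[of _ "insert A K'"]) auto
qed

text \<open>Drawing \<open>k\<close> points without replacement costs at most a factor 2 compared
  with drawing with replacement: \<open>s\<close> is at least \<open>2 * k^2\<close>, so the falling
  factorial of \<open>s\<close> is at least \<open>(s - k) ^ k\<close>, hence at least half of
  \<open>(n / a) ^ k\<close>, while that of \<open>n\<close> is at most
  \<open>n ^ k\<close>.\<close>

lemma binomial_ratio_lower_bound:
  fixes a :: real and n k s :: nat
  assumes a: "a > 0" and s: "n / a \<le> s" and n: "2 * a * (real k)\<^sup>2 \<le> n" and k: "k \<ge> 1"
  shows "(n choose k) / (2 * a ^ k) \<le> s choose k"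
proof -
  have "2 * (real k)\<^sup>2 \<le> n / a" using n a by (simp add: field_simps)
  then have ks: "2 * (real k)\<^sup>2 \<le> s" using s by linarith
  have kk: "real k \<le> (real k)\<^sup>2" using k by (simp add: power2_eq_square)
  have s0: "0 < real s" "real k \<le> s" using ks kk k by linarith+
  have "real n ^ k / (2 * a ^ k) = (n / a) ^ k * (1 / 2)" by (simp add: power_divide)
  \<comment> \<open>The second factor is \<open>1 - k^2 / s\<close> in the shape of Bernoulli's
    inequality; it is at least 1/2 because \<open>s\<close> is at least
    \<open>2 * k^2\<close>.\<close>
  also have "\<dots> \<le> real s ^ k * (1 + real k * (- (real k / s)))"
  proof (intro mult_mono power_mono s)
    show "1 / 2 \<le> 1 + real k * - (real k / s)"
      using ks s0 by (simp add: field_simps power2_eq_square)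
  qed (use a in auto)
  also have "\<dots> \<le> real s ^ k * (1 + - (real k / s)) ^ k"
    by (intro mult_left_mono Bernoulli_inequality) (use s0 in auto)
  also have "\<dots> = (real s - k) ^ k"
    using s0 by (simp add: power_mult_distrib[symmetric] field_simps)
  also have "\<dots> = (\<Prod>i = 0..<k. real s - k)" by simp
  also have "\<dots> \<le> (\<Prod>i = 0..<k. real s - i)"
    by (intro prod_mono) (use s0 in auto)
  also have "\<dots> = (s choose k) * fact k"
    by (simp add: binomial_gbinomial gbinomial_prod_rev)
  finally have *: "real n ^ k / (2 * a ^ k) \<le> (s choose k) * fact k" .
  have "real ((n choose k) * fact k) \<le> real (n ^ k)"
    using binomial_fact_pow of_nat_le_iff by blast
  then have "real (n choose k) * fact k / (2 * a ^ k) \<le> real n ^ k / (2 * a ^ k)"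
    using a by (intro divide_right_mono) auto
  with * have "real (n choose k) / (2 * a ^ k) * fact k \<le> real (s choose k) * fact k" by simp
  then show ?thesis by (rule mult_right_le_imp_le) simp
qed

text \<open>Greedy covering over all \<open>k\<close>-subsets, related to the dense sets by
  inclusion. There are at most \<open>2 ^ n\<close> dense sets, so once the uncovered fraction is
  below \<open>1 / 2 ^ n\<close> none is left.\<close>

lemma subset_family_covering_dense_sets:
  fixes a :: real and n k :: nat
  assumes a: "a > 1" and n: "2 * a * (real k)\<^sup>2 \<le> n" and k: "k \<ge> 1"
  shows "\<exists>K. finite K \<and> (\<forall>A\<in>K. A \<subseteq> {..<n} \<and> card A = k) \<and> card K \<le> 5 * n * a ^ k \<and>
             (\<forall>S\<subseteq>{..<n}. n / a \<le> card S \<longrightarrow> (\<exists>A\<in>K. A \<subseteq> S))"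
proof -
  define Q where "Q = {A. A \<subseteq> {..<n} \<and> card A = k}"
  define U where "U = {S. S \<subseteq> {..<n} \<and> n / a \<le> card S}"
  define p where "p = 1 / (2 * a ^ k)"
  \<comment> \<open>Chosen so that \<open>p * N\<close> is at least \<open>2 * n\<close>; then
    \<open>(1 - p) ^ N\<close> is at most \<open>exp (- (2 * n))\<close>, which beats
    \<open>2 ^ n\<close>.\<close>
  define N where "N = nat \<lceil>4 * n * a ^ k\<rceil>"
  have ak: "1 \<le> a ^ k" using a by simp
  have p: "0 \<le> p" "p \<le> 1" using ak by (auto simp: p_def field_simps)
  have kk: "real k \<le> (real k)\<^sup>2" using k by (simp add: power2_eq_square)
  have "1 * (real k)\<^sup>2 \<le> 2 * a * (real k)\<^sup>2" using a by (intro mult_right_mono) auto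
  then have kn: "k \<le> n" using n kk by linarith
  have finQ: "finite Q" and cardQ: "card Q = n choose k"
    using n_subsets[of "{..<n}" k] by (auto simp: Q_def)
  then have "card Q > 0" using kn by simp
  then have neQ: "Q \<noteq> {}" by auto
  have finU: "finite U" unfolding U_def by simp
  have "U \<subseteq> Pow {..<n}" by (auto simp: U_def)
  then have "card U \<le> card (Pow {..<n})" by (intro card_mono) auto
  then have "card U \<le> 2 ^ n" by (simp add: card_Pow)
  then have cardU: "real (card U) \<le> 2 ^ n" by (metis of_nat_le_iff of_nat_numeral of_nat_power)
  have many: "p * card Q \<le> card {A \<in> Q. A \<subseteq> S}" if "S \<in> U" for S
  proof -
    have "{A \<in> Q. A \<subseteq> S} = {A. A \<subseteq> S \<and> card A = k}" using that by (auto simp: Q_def U_def)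
    moreover have "finite S" using that finite_subset by (auto simp: U_def)
    ultimately have "card {A \<in> Q. A \<subseteq> S} = card S choose k" by (simp add: n_subsets)
    then show ?thesis
      using binomial_ratio_lower_bound[of a n "card S" k] that a n k
      by (simp add: cardQ p_def U_def)
  qed
  obtain K where K: "K \<subseteq> Q" "card K \<le> N"
    and unc: "card {S \<in> U. \<forall>A\<in>K. \<not> A \<subseteq> S} \<le> (1 - p) ^ N * card U"
    using greedy_cover[of Q U p "(\<subseteq>)" N, OF finQ neQ finU many p(2)] by blast
  have Nge: "4 * n * a ^ k \<le> N" unfolding N_def by linarith
  have "(1 - p) ^ N \<le> exp (- p) ^ N"
    using p exp_ge_add_one_self[of "- p"] by (intro power_mono) auto
  also have "\<dots> = exp (- (p * N))" by (simp add: exp_of_nat_mult[symmetric] mult.commute)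
  also have "\<dots> \<le> exp (- (2 * n))"
    using mult_left_mono[OF Nge p(1)] a by (simp add: p_def)
  also have "\<dots> = inverse (exp 2 ^ n)"
    by (simp add: exp_minus exp_of_nat_mult[symmetric] mult.commute)
  finally have "(1 - p) ^ N * card U \<le> inverse (exp 2 ^ n) * 2 ^ n"
    using cardU by (intro mult_mono) auto
  also have "\<dots> < 1"
  proof -
    have "(2::real) ^ n < exp 2 ^ n"
      using exp_ge_add_one_self[of "2::real"] kn k by (intro power_strict_mono) auto
    then show ?thesis by (simp add: field_simps)
  qed
  finally have "card {S \<in> U. \<forall>A\<in>K. \<not> A \<subseteq> S} = 0" using unc by linarith
  then have "{S \<in> U. \<forall>A\<in>K. \<not> A \<subseteq> S} = {}" using finU by simp
  moreover have "real (card K) \<le> 5 * n * a ^ k"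
  proof -
    \<comment> \<open>Rounding up in \<open>N\<close> costs at most 1, which is at most
      \<open>n * a ^ k\<close>; this turns the factor 4 into 5.\<close>
    have "1 * 1 \<le> real n * a ^ k" using ak kn k by (intro mult_mono) auto
    moreover have "0 \<le> real (4 * n) * a ^ k" using ak by simp
    then have "real N \<le> 4 * n * a ^ k + 1" unfolding N_def by linarith
    ultimately show ?thesis using K(2) by linarith
  qed
  ultimately show ?thesis
    using K finQ finite_subset[of K Q] by (intro exI[of _ K]) (auto simp: Q_def U_def)
qed

lemma unsatisfiable_kcnf_with_few_occurrences:
  fixes a b :: real
  assumes a: "a > 1" and b: "b \<ge> a / (a - 1)"
  shows "\<exists>c. \<exists>k\<^sub>0::nat. \<forall>k\<ge>k\<^sub>0. \<exists>F :: nat literal set set. is_kcnf k F \<and> \<not> satisfiable F \<and>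
           (\<forall>x. real (occ F (Neg x)) \<le> c * (real k)\<^sup>2 * a ^ k \<and>
                real (occ F (Pos x)) \<le> c * (real k)\<^sup>2 * b ^ k)"
proof -
  have "1 < a / (a - 1)" using a by (simp add: field_simps)
  then have b1: "b > 1" using b by linarith
  \<comment> \<open>The hypothesis on \<open>b\<close> in the form needed: the densities
    \<open>1 / a\<close> and \<open>1 / b\<close> sum to at most 1, so a set and its complement
    cannot both fall short of them.\<close>
  have ab: "1 / a + 1 / b \<le> 1"
  proof -
    have "1 / b \<le> 1 / (a / (a - 1))" using a b b1 by (intro divide_left_mono) auto
    also have "\<dots> = 1 - 1 / a" using a by (simp add: field_simps)
    finally show ?thesis by simp
  qed
  \<comment> \<open>\<open>L\<close> does not depend on \<open>k\<close>: \<open>n = L * k^2\<close>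
    is large enough for both covering families, and \<open>c = 5 * L\<close> is a constant.\<close>
  obtain L :: nat where L: "2 * max a b \<le> L" using real_arch_simple by blast
  have "\<exists>F :: nat literal set set. is_kcnf k F \<and> \<not> satisfiable F \<and>
           (\<forall>x. real (occ F (Neg x)) \<le> 5 * L * (real k)\<^sup>2 * a ^ k \<and>
                real (occ F (Pos x)) \<le> 5 * L * (real k)\<^sup>2 * b ^ k)" if k: "k \<ge> 1" for k
  proof -
    define n where "n = L * k\<^sup>2"
    have na: "2 * a * (real k)\<^sup>2 \<le> n" and nb: "2 * b * (real k)\<^sup>2 \<le> n"
      using L by (auto simp: n_def intro!: mult_right_mono)
    obtain A where A: "finite A" "\<forall>X\<in>A. X \<subseteq> {..<n} \<and> card X = k" "card A \<le> 5 * n * a ^ k"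
      "\<forall>S\<subseteq>{..<n}. n / a \<le> card S \<longrightarrow> (\<exists>X\<in>A. X \<subseteq> S)"
      using subset_family_covering_dense_sets[OF a na k] by blast
    obtain B where B: "finite B" "\<forall>X\<in>B. X \<subseteq> {..<n} \<and> card X = k" "card B \<le> 5 * n * b ^ k"
      "\<forall>S\<subseteq>{..<n}. n / b \<le> card S \<longrightarrow> (\<exists>X\<in>B. X \<subseteq> S)"
      using subset_family_covering_dense_sets[OF b1 nb k] by blast
    define F where "F = (`) Neg ` A \<union> (`) Pos ` B"
    have fin: "finite X" if "X \<in> A \<union> B" for X
      using that A(2) B(2) finite_subset[of X "{..<n}"] by auto
    have "is_kcnf k F"
      using A(1,2) B(1,2) fin
      by (auto simp: is_kcnf_def is_cnf_def is_clause_def F_def card_image inj_on_def)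
    moreover have "\<not> satisfiable F"
    proof
      assume "satisfiable F"
      then obtain \<alpha> where \<alpha>: "\<forall>C\<in>F. \<exists>u\<in>C. lit_true \<alpha> u" unfolding satisfiable_def by blast
      define T where "T = {x. x < n \<and> \<alpha> x}"
      have T: "T \<subseteq> {..<n}" by (auto simp: T_def)
      then have "card ({..<n} - T) = n - card T" "card T \<le> n"
        using card_Diff_subset[of T "{..<n}"] finite_subset[of T] card_mono[of "{..<n}" T] by auto
      then have "real (card ({..<n} - T)) = n - real (card T)" by (simp add: of_nat_diff)
      moreover have "n / a + n / b \<le> n"
        using mult_left_mono[OF ab, of n] by (simp add: distrib_left)
      ultimately consider "n / a \<le> card T" | "n / b \<le> card ({..<n} - T)" by linarith
      then show False
      proof cases
        case 1
        then obtain X where X: "X \<in> A" "X \<subseteq> T" using A(4) T by blast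
        then have "Neg ` X \<in> F" by (simp add: F_def)
        then obtain x where "x \<in> X" "\<not> \<alpha> x" using \<alpha> by fastforce
        then show False using X by (auto simp: T_def)
      next
        case 2
        then obtain X where X: "X \<in> B" "X \<subseteq> {..<n} - T" using B(4) Diff_subset by metis
        then have "Pos ` X \<in> F" by (simp add: F_def)
        then obtain x where "x \<in> X" "\<alpha> x" using \<alpha> by fastforce
        then show False using X by (auto simp: T_def)
      qed
    qed
    moreover have "real (occ F (Neg x)) \<le> 5 * L * (real k)\<^sup>2 * a ^ k" for x
    proof -
      have "{C \<in> F. Neg x \<in> C} \<subseteq> (`) Neg ` A" by (auto simp: F_def)
      then have "occ F (Neg x) \<le> card A"
        unfolding occ_def using A(1) surj_card_le by blast
      then show ?thesis using A(3) by (simp add: n_def)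
    qed
    moreover have "real (occ F (Pos x)) \<le> 5 * L * (real k)\<^sup>2 * b ^ k" for x
    proof -
      have "{C \<in> F. Pos x \<in> C} \<subseteq> (`) Pos ` B" by (auto simp: F_def)
      then have "occ F (Pos x) \<le> card B"
        unfolding occ_def using B(1) surj_card_le by blast
      then show ?thesis using B(3) by (simp add: n_def)
    qed
    ultimately show ?thesis by blast
  qed
  then show ?thesis by blast
qed

section \<open>Independent biased assignments and negative correlation\<close>

section \<open>Expectation under a biased random assignment\<close>

text \<open>
  The variables in the list are made true independently with probability \<open>p\<close>, all others are
  false. For a variable repeated in the list, the first occurrence decides.
\<close>

fun expect :: "real \<Rightarrow> 'v list \<Rightarrow> (('v \<Rightarrow> bool) \<Rightarrow> real) \<Rightarrow> real" where
  "expect p [] f = f (\<lambda>_. False)"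
| "expect p (x # xs) f =
     p * expect p xs (\<lambda>\<alpha>. f (\<alpha>(x := True))) + (1 - p) * expect p xs (\<lambda>\<alpha>. f (\<alpha>(x := False)))"

lemma expect_add: "expect p xs (\<lambda>\<alpha>. f \<alpha> + g \<alpha>) = expect p xs f + expect p xs g"
  by (induction xs arbitrary: f g) (simp_all add: algebra_simps)

lemma expect_const: "expect p xs (\<lambda>\<alpha>. c) = c"
  by (induction xs) (simp_all add: algebra_simps)

lemma expect_sum: "expect p xs (\<lambda>\<alpha>. \<Sum>i\<in>I. f i \<alpha>) = (\<Sum>i\<in>I. expect p xs (f i))"
  by (induction I rule: infinite_finite_induct) (simp_all add: expect_const expect_add)

context
  fixes p :: real
  assumes p: "0 \<le> p" "p \<le> 1"
begin

lemma expect_mono: "(\<And>\<alpha>. f \<alpha> \<le> g \<alpha>) \<Longrightarrow> expect p xs f \<le> expect p xs g"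
  using p by (induction xs arbitrary: f g) (auto intro!: add_mono mult_left_mono)

text \<open>A Harris-type inequality; variables on which \<open>f\<close> does not depend are unrestricted in \<open>g\<close>.\<close>

lemma expect_mult_le:
  assumes "\<And>x. (\<forall>\<alpha>. f (\<alpha>(x := True)) = f (\<alpha>(x := False))) \<or>
      (\<forall>\<alpha>. f (\<alpha>(x := True)) \<le> f (\<alpha>(x := False)) \<and> g (\<alpha>(x := False)) \<le> g (\<alpha>(x := True))) \<or>
      (\<forall>\<alpha>. f (\<alpha>(x := False)) \<le> f (\<alpha>(x := True)) \<and> g (\<alpha>(x := True)) \<le> g (\<alpha>(x := False)))"
  shows "expect p xs (\<lambda>\<alpha>. f \<alpha> * g \<alpha>) \<le> expect p xs f * expect p xs g"
  using assms
proof (induction xs arbitrary: f g)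
  case Nil
  show ?case by simp
next
  case (Cons x xs)
  define f1 f0 g1 g0 where
    "f1 = expect p xs (\<lambda>\<alpha>. f (\<alpha>(x := True)))" "f0 = expect p xs (\<lambda>\<alpha>. f (\<alpha>(x := False)))"
    "g1 = expect p xs (\<lambda>\<alpha>. g (\<alpha>(x := True)))" "g0 = expect p xs (\<lambda>\<alpha>. g (\<alpha>(x := False)))"
  note defs = this
  have IH: "expect p xs (\<lambda>\<alpha>. f (\<alpha>(x := v)) * g (\<alpha>(x := v)))
      \<le> expect p xs (\<lambda>\<alpha>. f (\<alpha>(x := v))) * expect p xs (\<lambda>\<alpha>. g (\<alpha>(x := v)))" for v
  proof (rule Cons.IH, goal_cases)
    case (1 y)
    show ?case
    \<comment> \<open>Updates of distinct variables commute, so the hypothesis at \<open>y\<close>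
      carries over. For \<open>y = x\<close> the restricted \<open>f\<close> ignores
      \<open>y\<close>, and the first alternative holds.\<close>
    proof (cases "y = x")
      case False
      then have "\<alpha>(y := w, x := v) = \<alpha>(x := v, y := w)" for \<alpha> w by (simp add: fun_upd_twist)
      then show ?thesis using Cons.prems[of y] by (simp only:) blast
    qed simp
  qed
  have "(f1 - f0) * (g1 - g0) \<le> 0"
    using Cons.prems[of x]
  proof (elim disjE)
    assume "\<forall>\<alpha>. f (\<alpha>(x := True)) = f (\<alpha>(x := False))"
    then show ?thesis by (simp add: defs)
  next
    assume "\<forall>\<alpha>. f (\<alpha>(x := True)) \<le> f (\<alpha>(x := False)) \<and> g (\<alpha>(x := False)) \<le> g (\<alpha>(x := True))"
    then have "f1 \<le> f0" "g0 \<le> g1" unfolding defs by (auto intro: expect_mono)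
    then show ?thesis by (simp add: mult_nonpos_nonneg)
  next
    assume "\<forall>\<alpha>. f (\<alpha>(x := False)) \<le> f (\<alpha>(x := True)) \<and> g (\<alpha>(x := True)) \<le> g (\<alpha>(x := False))"
    then have "f0 \<le> f1" "g1 \<le> g0" unfolding defs by (auto intro: expect_mono)
    then show ?thesis by (simp add: mult_nonneg_nonpos)
  qed
  moreover have "0 \<le> p * (1 - p)" using p by simp
  ultimately have "p * (1 - p) * ((f1 - f0) * (g1 - g0)) \<le> 0" by (rule mult_nonneg_nonpos[rotated])
  \<comment> \<open>The left side minus the right side is exactly
    \<open>p * (1 - p) * ((f1 - f0) * (g1 - g0))\<close>.\<close>
  then have "p * (f1 * g1) + (1 - p) * (f0 * g0) \<le> (p * f1 + (1 - p) * f0) * (p * g1 + (1 - p) * g0)"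
    by (simp add: algebra_simps)
  moreover have "p * expect p xs (\<lambda>\<alpha>. f (\<alpha>(x := True)) * g (\<alpha>(x := True))) \<le> p * (f1 * g1)"
    unfolding defs by (intro mult_left_mono IH p)
  moreover have "(1 - p) * expect p xs (\<lambda>\<alpha>. f (\<alpha>(x := False)) * g (\<alpha>(x := False))) \<le> (1 - p) * (f0 * g0)"
    unfolding defs using p by (intro mult_left_mono IH) auto
  ultimately show ?case by (simp add: defs)
qed

end

section \<open>Falsified clauses as events, with conflicts as dependencies\<close>

section \<open>The lopsided local lemma for CNF formulas\<close>

definition models :: "('v \<Rightarrow> bool) \<Rightarrow> 'v literal set set \<Rightarrow> bool" where
  "models \<alpha> S \<longleftrightarrow> (\<forall>C\<in>S. \<exists>u\<in>C. lit_true \<alpha> u)"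

definition falsifies :: "('v \<Rightarrow> bool) \<Rightarrow> 'v literal set \<Rightarrow> bool" where
  "falsifies \<alpha> C \<longleftrightarrow> (\<forall>u\<in>C. \<not> lit_true \<alpha> u)"

definition conflict :: "'v literal set \<Rightarrow> 'v literal set \<Rightarrow> bool" where
  "conflict C D \<longleftrightarrow> (\<exists>x. Pos x \<in> C \<and> Neg x \<in> D \<or> Neg x \<in> C \<and> Pos x \<in> D)"

text \<open>The probability that a clause is falsified when variables are independently true with
  probability \<open>p\<close>: a negative literal fails exactly when its variable is true.\<close>

definition falsity_weight :: "real \<Rightarrow> 'v literal set \<Rightarrow> real" where
  "falsity_weight p C = p ^ card {x. Neg x \<in> C} * (1 - p) ^ card {x. Pos x \<in> C}"

fun var_of :: "'v literal \<Rightarrow> 'v" where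
  "var_of (Pos x) = x"
| "var_of (Neg x) = x"

lemma lit_true_upd: "lit_true (\<alpha>(x := v)) u \<longleftrightarrow>
    (if var_of u = x then u = (if v then Pos x else Neg x) else lit_true \<alpha> u)"
  by (cases u) auto

lemma lit_true_upd_mono:
  assumes "lit_true (\<alpha>(x := v)) u" "u \<noteq> (if v then Pos x else Neg x)"
  shows "lit_true (\<alpha>(x := w)) u"
  using assms by (auto simp: lit_true_upd split: if_splits)

lemma var_of_eq_iff: "var_of u = x \<longleftrightarrow> u = Pos x \<or> u = Neg x"
  by (cases u) auto

lemma finite_literal_vars:
  assumes "finite C"
  shows "finite {x. Pos x \<in> C}" "finite {x. Neg x \<in> C}"
proof -
  have "{x. Pos x \<in> C} = Pos -` C" "{x. Neg x \<in> C} = Neg -` C" by auto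
  then show "finite {x. Pos x \<in> C}" "finite {x. Neg x \<in> C}"
    using assms by (auto intro!: finite_vimageI simp: inj_def)
qed

text \<open>Separates the condition on \<open>x\<close> from the rest of the clause, matching the
  recursion of \<open>expect\<close>.\<close>

lemma falsifies_upd: "falsifies (\<alpha>(x := v)) C \<longleftrightarrow>
    (if v then Pos x else Neg x) \<notin> C \<and> falsifies \<alpha> (C - {Pos x, Neg x})"
  unfolding falsifies_def lit_true_upd by (auto simp: var_of_eq_iff split: if_splits)

text \<open>Independence: a clause has at most one literal of the head variable, so peeling that
  variable off gives a factor \<open>p\<close>, \<open>1 - p\<close>, or their sum 1. The rest of
  the clause no longer mentions it, so repetitions in the list are harmless.\<close>

lemma expect_falsifies:
  assumes "is_clause C" "var_of ` C \<subseteq> set xs"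
  shows "expect p xs (\<lambda>\<alpha>. of_bool (falsifies \<alpha> C)) = falsity_weight p C"
  using assms
proof (induction xs arbitrary: C)
  case Nil
  then show ?case by (simp add: falsifies_def falsity_weight_def)
next
  case (Cons x xs)
  let ?D = "C - {Pos x, Neg x}"
  have fin: "finite {y. Pos y \<in> C}" "finite {y. Neg y \<in> C}"
    using Cons.prems finite_literal_vars by (auto simp: is_clause_def)
  have "is_clause ?D" using Cons.prems by (auto simp: is_clause_def)
  moreover have "var_of ` ?D \<subseteq> set xs"
  proof
    fix y assume "y \<in> var_of ` ?D"
    then obtain u where "u \<in> C" "y = var_of u" "var_of u \<noteq> x" by (auto simp: var_of_eq_iff)
    then show "y \<in> set xs" using Cons.prems by auto
  qed
  ultimately have IH: "expect p xs (\<lambda>\<alpha>. of_bool (falsifies \<alpha> ?D)) = falsity_weight p ?D"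
    by (rule Cons.IH)
  have *: "expect p (x # xs) (\<lambda>\<alpha>. of_bool (falsifies \<alpha> C)) =
      p * (of_bool (Pos x \<notin> C) * falsity_weight p ?D) +
      (1 - p) * (of_bool (Neg x \<notin> C) * falsity_weight p ?D)"
    by (cases "Pos x \<in> C"; cases "Neg x \<in> C")
      (simp_all add: falsifies_upd expect_const IH del: Diff_insert0)
  have P: "{y. Pos y \<in> ?D} = {y. Pos y \<in> C} - {x}" and N: "{y. Neg y \<in> ?D} = {y. Neg y \<in> C} - {x}"
    by auto
  consider "Pos x \<in> C" "Neg x \<notin> C" | "Pos x \<notin> C" "Neg x \<in> C" | "Pos x \<notin> C" "Neg x \<notin> C"
    using Cons.prems by (auto simp: is_clause_def)
  then show ?case
  proof cases
    case 1
    then have "card {y. Pos y \<in> C} = Suc (card ({y. Pos y \<in> C} - {x}))"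
      using fin by (intro card.remove) auto
    moreover have "{y. Neg y \<in> C} - {x} = {y. Neg y \<in> C}" using 1 by simp
    ultimately show ?thesis using 1 unfolding * falsity_weight_def P N by (simp only: power_Suc) simp
  next
    case 2
    then have "card {y. Neg y \<in> C} = Suc (card ({y. Neg y \<in> C} - {x}))"
      using fin by (intro card.remove) auto
    moreover have "{y. Pos y \<in> C} - {x} = {y. Pos y \<in> C}" using 2 by simp
    ultimately show ?thesis using 2 unfolding * falsity_weight_def P N by (simp only: power_Suc) simp
  next
    case 3
    then show ?thesis unfolding * by (simp add: algebra_simps)
  qed
qed

text \<open>Moving \<open>x\<close> away from \<open>v\<close> can falsify only the literal of
  \<open>x\<close> that \<open>v\<close> makes true. As no clause of \<open>S\<close> contains it,
  every clause keeps a true literal.\<close>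

lemma models_upd_mono:
  assumes "models (\<alpha>(x := v)) S" "\<And>D. D \<in> S \<Longrightarrow> (if v then Pos x else Neg x) \<notin> D"
  shows "models (\<alpha>(x := w)) S"
  unfolding models_def
proof
  fix D assume D: "D \<in> S"
  then obtain u where u: "u \<in> D" "lit_true (\<alpha>(x := v)) u" using assms(1) by (auto simp: models_def)
  then have "u \<noteq> (if v then Pos x else Neg x)" using assms(2)[OF D] by metis
  then show "\<exists>u\<in>D. lit_true (\<alpha>(x := w)) u" using lit_true_upd_mono u by metis
qed

text \<open>Making \<open>C\<close> false can only hurt clauses that do not conflict with \<open>C\<close>.\<close>

lemma expect_falsifies_nonconflicting:
  assumes p: "0 \<le> p" "p \<le> 1" and C: "is_clause C" and S: "\<And>D. D \<in> S \<Longrightarrow> \<not> conflict C D"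
  shows "expect p xs (\<lambda>\<alpha>. of_bool (falsifies \<alpha> C) * of_bool (models \<alpha> S))
    \<le> expect p xs (\<lambda>\<alpha>. of_bool (falsifies \<alpha> C)) * expect p xs (\<lambda>\<alpha>. of_bool (models \<alpha> S))"
proof (rule expect_mult_le[OF p], goal_cases)
  case (1 x)
  consider "Pos x \<in> C" "Neg x \<notin> C" | "Pos x \<notin> C" "Neg x \<in> C" | "Pos x \<notin> C" "Neg x \<notin> C"
    using C by (auto simp: is_clause_def)
  then show ?case
  proof cases
    case 1
    then have "\<And>D. D \<in> S \<Longrightarrow> Neg x \<notin> D" using S by (auto simp: conflict_def)
    then have "models (\<alpha>(x := False)) S \<Longrightarrow> models (\<alpha>(x := True)) S" for \<alpha>
      using models_upd_mono[of \<alpha> x False S True] by simp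
    then show ?thesis using 1 by (auto simp: falsifies_upd)
  next
    case 2
    then have "\<And>D. D \<in> S \<Longrightarrow> Pos x \<notin> D" using S by (auto simp: conflict_def)
    then have "models (\<alpha>(x := True)) S \<Longrightarrow> models (\<alpha>(x := False)) S" for \<alpha>
      using models_upd_mono[of \<alpha> x True S False] by simp
    then show ?thesis using 2 by (auto simp: falsifies_upd)
  next
    case 3
    then show ?thesis by (auto simp: falsifies_upd)
  qed
qed

text \<open>Conditioned on satisfying a subset \<open>S\<close>, a clause fails with probability at
  most twice its weight, hence at most 1/2. Adding the clauses one by one therefore keeps the
  probability of satisfying all of them positive.\<close>

lemma lopsided_local_lemma:
  fixes G :: "'v literal set set"
  assumes p: "0 \<le> p" "p \<le> 1" and G: "is_cnf G"
    and small: "\<And>C. C \<in> G \<Longrightarrow> falsity_weight p C \<le> 1 / 4"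
    and nbrs: "\<And>C. C \<in> G \<Longrightarrow> (\<Sum>D | D \<in> G \<and> conflict C D. falsity_weight p D) \<le> 1 / 4"
  shows "satisfiable G"
proof -
  have finG: "finite G" and cl: "\<And>C. C \<in> G \<Longrightarrow> is_clause C" using G by (auto simp: is_cnf_def)
  then have "finite (\<Union>C\<in>G. var_of ` C)" by (auto simp: is_clause_def)
  from finite_list[OF this] obtain xs where xs: "set xs = (\<Union>C\<in>G. var_of ` C)" ..
  define M where "M S = expect p xs (\<lambda>\<alpha>. of_bool (models \<alpha> S))" for S
  define B where "B C S = expect p xs (\<lambda>\<alpha>. of_bool (falsifies \<alpha> C) * of_bool (models \<alpha> S))" for C S
  let ?w = "falsity_weight p"
  have w0: "0 \<le> ?w C" for C :: "'v literal set" using p by (simp add: falsity_weight_def)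
  have w: "expect p xs (\<lambda>\<alpha>. of_bool (falsifies \<alpha> C)) = ?w C" if "C \<in> G" for C
    using that cl xs by (intro expect_falsifies) auto
  have M0: "0 \<le> M S" for S
    using expect_mono[OF p, of "\<lambda>_. 0" "\<lambda>\<alpha>. of_bool (models \<alpha> S)" xs] by (simp add: M_def expect_const)
  \<comment> \<open>The conditional bound is multiplied out by \<open>M S\<close>, so it can be
    proved before \<open>M S\<close> is known to be positive.\<close>
  have cond: "C \<in> G \<Longrightarrow> S \<subseteq> G \<Longrightarrow> B C S \<le> 2 * ?w C * M S" for C S
  proof (induction "card S" arbitrary: C S rule: less_induct)
    case less
    have finS: "finite S" using less.prems finG finite_subset by blast
    define S1 where "S1 = {D \<in> S. conflict C D}"
    define S2 where "S2 = S - S1"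
    have S2: "S2 \<subseteq> S" "S2 \<subseteq> G" using less.prems by (auto simp: S2_def)
    have "B C S \<le> B C S2"
      unfolding B_def by (intro expect_mono[OF p]) (auto simp: models_def S2_def)
    also have "\<dots> \<le> ?w C * M S2"
      unfolding B_def M_def w[OF less.prems(1), symmetric]
      by (intro expect_falsifies_nonconflicting[OF p cl[OF less.prems(1)]]) (auto simp: S2_def S1_def)
    finally have le: "B C S \<le> ?w C * M S2" .
    \<comment> \<open>Union bound: a model of \<open>S2\<close> but not of \<open>S\<close>
      falsifies a clause of \<open>S1\<close>. If \<open>S1\<close> is nonempty, \<open>S2\<close>
      is smaller than \<open>S\<close>, and the induction hypothesis with the neighbour bound limits
      this loss to \<open>M S2 / 2\<close>.\<close>
    have "M S2 \<le> 2 * M S"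
    proof (cases "S1 = {}")
      case True
      then show ?thesis using M0[of S] by (simp add: S2_def)
    next
      case False
      then have "S2 \<subset> S" by (auto simp: S1_def S2_def)
      then have lt: "card S2 < card S" using finS psubset_card_mono by blast
      have finS1: "finite S1" using finS by (simp add: S1_def)
      have "M S2 \<le> expect p xs (\<lambda>\<alpha>. of_bool (models \<alpha> S) +
          (\<Sum>D\<in>S1. of_bool (falsifies \<alpha> D) * of_bool (models \<alpha> S2)))"
        unfolding M_def
      proof (rule expect_mono[OF p])
        fix \<alpha>
        show "of_bool (models \<alpha> S2) \<le> of_bool (models \<alpha> S) +
          (\<Sum>D\<in>S1. of_bool (falsifies \<alpha> D) * of_bool (models \<alpha> S2) :: real)"
        proof (cases "models \<alpha> S2 \<and> \<not> models \<alpha> S")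
          case True
          then obtain D where D: "D \<in> S1" "falsifies \<alpha> D"
            by (auto simp: models_def falsifies_def S2_def)
          have "(1::real) = of_bool (falsifies \<alpha> D) * of_bool (models \<alpha> S2)" using D True by simp
          also have "\<dots> \<le> (\<Sum>D\<in>S1. of_bool (falsifies \<alpha> D) * of_bool (models \<alpha> S2))"
            using D finS1 by (intro member_le_sum) auto
          finally show ?thesis using True by simp
        next
          case False
          then show ?thesis by (auto intro: sum_nonneg)
        qed
      qed
      also have "\<dots> = M S + (\<Sum>D\<in>S1. B D S2)"
        by (simp only: expect_add expect_sum M_def B_def)
      also have "(\<Sum>D\<in>S1. B D S2) \<le> (\<Sum>D\<in>S1. 2 * ?w D * M S2)"
        using less.prems by (intro sum_mono less.hyps[OF lt] S2) (auto simp: S1_def)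
      also have "\<dots> = 2 * (\<Sum>D\<in>S1. ?w D) * M S2"
        by (simp add: sum_distrib_left sum_distrib_right)
      also have "\<dots> \<le> 2 * (1 / 4) * M S2"
      proof (intro mult_right_mono mult_left_mono M0)
        have "(\<Sum>D\<in>S1. ?w D) \<le> (\<Sum>D | D \<in> G \<and> conflict C D. ?w D)"
          using less.prems finG w0 by (intro sum_mono2) (auto simp: S1_def)
        then show "(\<Sum>D\<in>S1. ?w D) \<le> 1 / 4" using nbrs[OF less.prems(1)] by linarith
      qed auto
      finally show ?thesis by simp
    qed
    then have "?w C * M S2 \<le> ?w C * (2 * M S)" using w0 by (intro mult_left_mono)
    then show ?case using le by simp
  qed
  have pos: "S \<subseteq> G \<Longrightarrow> 0 < M S" if "finite S" for S
    using that
  proof (induction S)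
    case empty
    then show ?case by (simp add: M_def models_def expect_const)
  next
    case (insert C S)
    \<comment> \<open>Adding \<open>C\<close> loses at most \<open>B C S\<close>, which is at most
      half of \<open>M S\<close>.\<close>
    have "M S \<le> M (insert C S) + B C S"
      unfolding M_def B_def expect_add[symmetric]
      by (intro expect_mono[OF p]) (auto simp: models_def falsifies_def)
    moreover have "B C S \<le> 2 * ?w C * M S" using insert.prems by (intro cond) auto
    moreover have "2 * ?w C * M S \<le> 2 * (1 / 4) * M S"
      using insert.prems small M0 by (intro mult_right_mono mult_left_mono) auto
    moreover have "0 < M S" using insert by simp
    ultimately show ?case by linarith
  qed
  have "\<exists>\<alpha>. models \<alpha> G"
  proof (rule ccontr)
    assume "\<nexists>\<alpha>. models \<alpha> G"
    then have "M G = 0" by (simp add: M_def expect_const)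
    then show False using pos[OF finG order_refl] by simp
  qed
  then show ?thesis by (simp add: satisfiable_def models_def)
qed

section \<open>Part (ii): truncated clauses and the balance of their weights\<close>

section \<open>Satisfiability under asymmetric occurrence bounds\<close>

text \<open>The comparison is strict: a tie stays whole, so a truncated clause has more than half of
  its original literals left.\<close>

definition truncate_negative :: "'v literal set \<Rightarrow> 'v literal set" where
  "truncate_negative C =
     (if card {x. Pos x \<in> C} < card {x. Neg x \<in> C} then range Neg \<inter> C else C)"

lemma truncate_negative_subset: "truncate_negative C \<subseteq> C"
  by (auto simp: truncate_negative_def)

lemma card_clause_eq:
  assumes "finite C"
  shows "card C = card {x. Pos x \<in> C} + card {x. Neg x \<in> C}"
proof -
  have "C = Pos ` {x. Pos x \<in> C} \<union> Neg ` {x. Neg x \<in> C}"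
  proof (rule set_eqI)
    fix u show "u \<in> C \<longleftrightarrow> u \<in> Pos ` {x. Pos x \<in> C} \<union> Neg ` {x. Neg x \<in> C}" by (cases u) auto
  qed
  then have "card C = card (Pos ` {x. Pos x \<in> C} \<union> Neg ` {x. Neg x \<in> C})" by simp
  also have "\<dots> = card (Pos ` {x. Pos x \<in> C}) + card (Neg ` {x. Neg x \<in> C})"
    using finite_literal_vars[OF assms] by (intro card_Un_disjoint) auto
  finally show ?thesis by (simp add: card_image inj_on_def)
qed

lemma satisfiable_truncate_negative:
  assumes "satisfiable (truncate_negative ` F)"
  shows "satisfiable F"
  using assms truncate_negative_subset unfolding satisfiable_def by (metis imageI subsetD)

text \<open>Truncation only removes literals and may merge clauses, so each new clause containing
  \<open>u\<close> comes from an old one containing \<open>u\<close>.\<close>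

lemma occ_truncate_negative_le:
  assumes "finite F"
  shows "occ (truncate_negative ` F) u \<le> occ F u"
proof -
  have "{D \<in> truncate_negative ` F. u \<in> D} \<subseteq> truncate_negative ` {D \<in> F. u \<in> D}"
    using truncate_negative_subset by blast
  moreover have "finite {D \<in> F. u \<in> D}" using assms by simp
  ultimately show ?thesis unfolding occ_def by (rule surj_card_le[rotated])
qed

lemma sum_Union_le:
  fixes w :: "'b \<Rightarrow> real"
  assumes "finite I" "\<And>i. i \<in> I \<Longrightarrow> finite (A i)" "\<And>x. 0 \<le> w x"
  shows "sum w (\<Union>i\<in>I. A i) \<le> (\<Sum>i\<in>I. sum w (A i))"
  using assms
proof (induction I)
  case (insert i I)
  have "sum w (A i \<union> (\<Union>j\<in>I. A j)) \<le> sum w (A i) + sum w (\<Union>j\<in>I. A j)"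
    using insert sum.union_inter[of "A i" "\<Union>j\<in>I. A j" w] sum_nonneg[of "A i \<inter> (\<Union>j\<in>I. A j)" w]
    by force
  then show ?case using insert by fastforce
qed simp

text \<open>After truncation the clauses containing any given literal have total weight at most
  \<open>1 / (8 * k)\<close>. A clause has at most \<open>k\<close> literals, so its conflicting
  clauses weigh at most 1/8 together, within the 1/4 of the local lemma.\<close>

lemma kcnf_satisfiable_of_few_occurrences:
  fixes a b :: real and F :: "'v literal set set"
  assumes a: "1 < a" "a < sqrt 2" and b: "b = sqrt (a ^ 4 / (a\<^sup>2 - 1))"
    and k: "k \<ge> 1" and F: "is_kcnf k F"
    and occ_Pos: "\<And>x. real (occ F (Pos x)) \<le> b ^ k / (8 * real k)"
    and occ_Neg: "\<And>x. real (occ F (Neg x)) \<le> a ^ k / (8 * real k)"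
  shows "satisfiable F"
proof -
  define p where "p = 1 / a\<^sup>2"
  have a2: "1 < a\<^sup>2" "a\<^sup>2 < 2"
    using a power_strict_mono[of 1 a 2] power_strict_mono[of a "sqrt 2" 2] by auto
  have b2: "b\<^sup>2 = a ^ 4 / (a\<^sup>2 - 1)" using b a2 by simp
  have b0: "0 < b" using b a a2 by simp
  have p: "0 < p" "p \<le> 1" "1 - p \<le> p" using a2 by (auto simp: p_def divide_simps)
  have a4: "a ^ 4 = a\<^sup>2 * a\<^sup>2" by (simp add: power2_eq_square power4_eq_xxxx)
  have "1 / A * (1 - 1 / A) = 1 / (A * A / (A - 1))" if "1 < A" for A :: real
    using that by (simp add: field_simps)
  then have pb: "p * (1 - p) = 1 / b\<^sup>2"
    unfolding b2 p_def a4 using a2(1) .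
  \<comment> \<open>Bounds the factor contributed by each positive literal in excess of the negative
    ones.\<close>
  have "(1 - p)\<^sup>2 \<le> p * (1 - p)"
    unfolding power2_eq_square using p by (intro mult_right_mono) auto
  then have "(1 - p)\<^sup>2 \<le> (1 / b)\<^sup>2" unfolding pb by (simp add: power_divide)
  then have qb: "1 - p \<le> 1 / b" using b0 by (auto intro: power2_le_imp_le)
  \<comment> \<open>\<open>a\<close> at most \<open>b\<close> is needed because a negative literal
    may also occur in untruncated clauses, whose weight is bounded only by
    \<open>1 / b ^ k\<close>.\<close>
  have "a\<^sup>2 * (a\<^sup>2 - 1) \<le> a ^ 4" unfolding a4 by (intro mult_left_mono) auto
  moreover have "0 < a\<^sup>2 - 1" using a2 by simp
  ultimately have "a\<^sup>2 \<le> b\<^sup>2" unfolding b2 by (simp only: pos_le_divide_eq)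
  then have ab: "a \<le> b" using b0 by (auto intro: power2_le_imp_le)
  let ?w = "falsity_weight p"
  define G where "G = truncate_negative ` F"
  have finF: "finite F" and clF: "\<And>C. C \<in> F \<Longrightarrow> is_clause C \<and> card C = k"
    using F by (auto simp: is_kcnf_def is_cnf_def)
  have clG: "is_clause D \<and> card D \<le> k" if "D \<in> G" for D
  proof -
    obtain C where C: "C \<in> F" "D = truncate_negative C" using \<open>D \<in> G\<close> by (auto simp: G_def)
    then have "D \<subseteq> C" using truncate_negative_subset by simp
    then show ?thesis using clF[OF C(1)] card_mono[of C D] finite_subset[of D C]
      by (auto simp: is_clause_def)
  qed
  have finG: "finite G" using finF by (simp add: G_def)
  have occG: "occ G u \<le> occ F u" for u using occ_truncate_negative_le[OF finF] by (simp add: G_def)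
  have weight: "(\<exists>x. Neg x \<in> D) \<and> (\<forall>x. Pos x \<notin> D) \<and> ?w D \<le> 1 / a ^ k
      \<or> (\<exists>x. Pos x \<in> D) \<and> ?w D \<le> 1 / b ^ k" if "D \<in> G" for D
  proof -
    obtain C where C: "C \<in> F" "D = truncate_negative C" using \<open>D \<in> G\<close> by (auto simp: G_def)
    define i j where "i = card {x. Neg x \<in> C}" and "j = card {x. Pos x \<in> C}"
    have ij: "j + i = k"
      using clF[OF C(1)] card_clause_eq[of C] by (auto simp: i_def j_def is_clause_def)
    show ?thesis
    proof (cases "j < i")
      case True
      then have D: "D = range Neg \<inter> C" by (simp add: C truncate_negative_def i_def j_def)
      have "i \<noteq> 0" using True by simp
      then have "\<exists>x. Neg x \<in> C" by (auto simp: i_def card_eq_0_iff)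
      moreover have "{x. Neg x \<in> D} = {x. Neg x \<in> C}" "{x. Pos x \<in> D} = {}" by (auto simp: D)
      then have "?w D = p ^ i" by (simp add: falsity_weight_def i_def)
      then have "?w D = 1 / a ^ (2 * i)" by (simp add: p_def power_divide power_mult)
      moreover have "1 / a ^ (2 * i) \<le> 1 / a ^ k"
        using a ij True by (intro divide_left_mono power_increasing) auto
      ultimately show ?thesis by (auto simp: D)
    next
      case False
      then have D: "D = C" by (simp add: C truncate_negative_def i_def j_def)
      have "j \<noteq> 0" using False ij k by auto
      then have "\<exists>x. Pos x \<in> C" by (auto simp: j_def card_eq_0_iff)
      moreover have "?w D = p ^ i * (1 - p) ^ j" by (simp add: D falsity_weight_def i_def j_def)
      \<comment> \<open>Each of the \<open>i\<close> negative literals is paired with a positive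
        one, a pair contributing \<open>1 / b^2\<close>; the \<open>j - i\<close> positive literals
        left over contribute at most \<open>1 / b\<close> each.\<close>
      moreover have "\<dots> = (p * (1 - p)) ^ i * (1 - p) ^ (j - i)"
        using False by (simp add: power_mult_distrib mult.assoc flip: power_add)
      moreover have "\<dots> \<le> (1 / b\<^sup>2) ^ i * (1 / b) ^ (j - i)"
        unfolding pb using p qb b0 by (intro mult_left_mono power_mono) auto
      moreover have "\<dots> = 1 / b ^ k"
      proof -
        have "k = 2 * i + (j - i)" using ij False by simp
        then have "b ^ k = (b\<^sup>2) ^ i * b ^ (j - i)" by (simp only: power_add power_mult)
        then show ?thesis by (simp add: power_divide)
      qed
      ultimately show ?thesis by (auto simp: D)
    qed
  qed
  have ak: "0 < a ^ k" and bk: "0 < b ^ k" and abk: "1 / b ^ k \<le> 1 / a ^ k"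
    using a b0 ab by (auto intro!: divide_left_mono power_mono)
  have sum_Neg: "(\<Sum>D | D \<in> G \<and> Neg x \<in> D. ?w D) \<le> 1 / (8 * real k)" for x
  proof -
    have "(\<Sum>D | D \<in> G \<and> Neg x \<in> D. ?w D) \<le> of_nat (occ G (Neg x)) * (1 / a ^ k)"
      unfolding occ_def by (intro sum_bounded_above) (use weight abk in fastforce)
    also have "\<dots> \<le> a ^ k / (8 * real k) * (1 / a ^ k)"
      using ak occ_Neg[of x] occG[of "Neg x"] by (intro mult_right_mono) auto
    finally show ?thesis using a by simp
  qed
  have sum_Pos: "(\<Sum>D | D \<in> G \<and> Pos x \<in> D. ?w D) \<le> 1 / (8 * real k)" for x
  proof -
    have "(\<Sum>D | D \<in> G \<and> Pos x \<in> D. ?w D) \<le> of_nat (occ G (Pos x)) * (1 / b ^ k)"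
      unfolding occ_def
    proof (rule sum_bounded_above)
      fix D assume "D \<in> {D \<in> G. Pos x \<in> D}"
      \<comment> \<open>A clause containing a positive literal was not truncated, so only the second
        alternative of \<open>weight\<close> remains.\<close>
      then show "?w D \<le> 1 / b ^ k" using weight[of D] by blast
    qed
    also have "\<dots> \<le> b ^ k / (8 * real k) * (1 / b ^ k)"
      using bk occ_Pos[of x] occG[of "Pos x"] by (intro mult_right_mono) auto
    finally show ?thesis using b0 by simp
  qed
  have w0: "0 \<le> ?w C" for C :: "'v literal set" using p by (simp add: falsity_weight_def)
  have k8: "1 / (8 * real k) \<le> 1 / 4" using k by (simp add: field_simps)
  have "satisfiable G"
  proof (rule lopsided_local_lemma)
    show "0 \<le> p" "p \<le> 1" using p by auto
    show "is_cnf G" using clG finG by (auto simp: is_cnf_def)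
    fix C assume C: "C \<in> G"
    show "?w C \<le> 1 / 4"
    proof -
      \<comment> \<open>A single weight is at most the total over all clauses sharing one of its
        literals, and the clause is nonempty by \<open>weight\<close>.\<close>
      have "?w C \<le> (\<Sum>D | D \<in> G \<and> u \<in> D. ?w D)" if "u \<in> C" for u
        using C that finG w0 by (intro member_le_sum) auto
      moreover obtain x where "Neg x \<in> C \<or> Pos x \<in> C" using weight[OF C] by blast
      ultimately show ?thesis using sum_Neg[of x] sum_Pos[of x] k8 by fastforce
    qed
    \<comment> \<open>The clauses containing the complement of \<open>u\<close>; those conflicting
      with \<open>C\<close> are covered by these sets over the literals of \<open>C\<close>,
      possibly with overlaps.\<close>
    define neighbours where
      "neighbours u = {D \<in> G. (case u of Pos x \<Rightarrow> Neg x | Neg x \<Rightarrow> Pos x) \<in> D}" for u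
    have "{D \<in> G. conflict C D} \<subseteq> (\<Union>u\<in>C. neighbours u)"
      by (force simp: conflict_def neighbours_def)
    then have "(\<Sum>D | D \<in> G \<and> conflict C D. ?w D) \<le> sum ?w (\<Union>u\<in>C. neighbours u)"
      using finG w0 clG[OF C]
      by (intro sum_mono2) (auto simp: neighbours_def is_clause_def)
    also have "\<dots> \<le> (\<Sum>u\<in>C. sum ?w (neighbours u))"
      using clG[OF C] finG w0 by (intro sum_Union_le) (auto simp: is_clause_def neighbours_def)
    also have "\<dots> \<le> of_nat (card C) * (1 / (8 * real k))"
    proof (rule sum_bounded_above)
      fix u show "sum ?w (neighbours u) \<le> 1 / (8 * real k)"
        using sum_Neg sum_Pos by (cases u) (auto simp: neighbours_def)
    qed
    also have "\<dots> \<le> real k * (1 / (8 * real k))"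
      using clG[OF C] by (intro mult_right_mono) auto
    also have "\<dots> \<le> 1 / 4" using k by simp
    finally show "(\<Sum>D | D \<in> G \<and> conflict C D. ?w D) \<le> 1 / 4" .
  qed
  then show ?thesis using satisfiable_truncate_negative by (simp add: G_def)
qed

theorem theorem2:
  shows "(\<forall>(a::real) (b::real). a > 1 \<longrightarrow> b \<ge> a / (a - 1) \<longrightarrow>
           (\<exists>c::real. \<exists>k\<^sub>0::nat. \<forall>k\<ge>k\<^sub>0. \<exists>F :: nat literal set set.
              is_kcnf k F \<and> \<not> satisfiable F \<and>
              (\<forall>x. real (occ F (Neg x)) \<le> c * (real k)\<^sup>2 * a ^ k \<and>
                   real (occ F (Pos x)) \<le> c * (real k)\<^sup>2 * b ^ k)))
       \<and> (\<forall>(a::real) (b::real). 1 < a \<longrightarrow> a < sqrt 2 \<longrightarrow> b = sqrt (a ^ 4 / (a\<^sup>2 - 1)) \<longrightarrow>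
           (\<forall>k::nat. \<forall>F :: 'v literal set set. k \<ge> 1 \<longrightarrow> is_kcnf k F \<longrightarrow>
              (\<forall>x. real (occ F (Pos x)) \<le> b ^ k / (8 * real k) \<and>
                   real (occ F (Neg x)) \<le> a ^ k / (8 * real k)) \<longrightarrow>
              satisfiable F))"
proof (intro conjI allI impI, goal_cases)
  case 1
  then show ?case by (rule unsatisfiable_kcnf_with_few_occurrences)
next
  case (2 a b k F)
  then show ?case by (intro kcnf_satisfiable_of_few_occurrences[of a b k F]) auto
qed

end
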